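(* Let $P$ and $Q$ be probability measures on a measurable space, and let $\mathcal{D}$ be a distinguisher that takes a sample from either $P$ or $Q$ and outputs '$P$' or '$Q$'. Let $A$ be the event that $\mathcal{D}$ outputs '$P$'. Let $\alpha=Q(A)$ be the probability of type I error, and let $\beta=1-P(A)$ be the probability of type II error. Regardless of the distinguisher $\mathcal{D}$, we must have $$\frac{(1-\beta)^2}{\alpha}+\frac{\beta^2}{1-\alpha}\le\mathbb{E}_Q\left[\left(\frac{dP}{dQ}\right)^2\right],$$ assuming the right-hand side is defined and finite. Furthermore, this is tight in the sense that for any $\alpha,\beta\in(0,1)$ there exist $P,Q,\mathcal{D}$ (with type I and type II error probabilities $\alpha$ and $\beta$) for which equality holds.
   Context: Here $dP/dQ$ denotes the Radon–Nikodym derivative of $P$ with respect to $Q$, and $\mathbb{E}_Q$ denotes expectation under $Q$. *)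

theory Defs
  imports "HOL-Probability.Probability"
begin

datatype verdict = Says_P | Says_Q

text \<open>
  A distinguisher may use internal randomness: it is a Markov kernel from the sample space
  to the two possible outputs. The distinguishers without internal randomness, for which the
  event that the output is \<open>Says_P\<close> is a measurable set of samples, are those of the form
  \<open>deterministic f\<close> with \<open>f\<close> measurable.
\<close>

definition distinguisher :: "'a measure \<Rightarrow> ('a \<Rightarrow> verdict measure) \<Rightarrow> bool" where
  "distinguisher M D \<longleftrightarrow> D \<in> M \<rightarrow>\<^sub>M prob_algebra (count_space UNIV)"

definition deterministic :: "('a \<Rightarrow> verdict) \<Rightarrow> 'a \<Rightarrow> verdict measure" where
  "deterministic f = (\<lambda>x. return (count_space UNIV) (f x))"

text \<open>\<open>M \<bind> D\<close> is the law of the output of \<open>D\<close> on a sample from \<open>M\<close>.\<close>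

definition prob_says_P :: "'a measure \<Rightarrow> ('a \<Rightarrow> verdict measure) \<Rightarrow> real" where
  "prob_says_P M D = measure (M \<bind> D) {Says_P}"

definition type_I_error :: "'a measure \<Rightarrow> ('a \<Rightarrow> verdict measure) \<Rightarrow> real" where
  "type_I_error Q D = prob_says_P Q D"

definition type_II_error :: "'a measure \<Rightarrow> ('a \<Rightarrow> verdict measure) \<Rightarrow> real" where
  "type_II_error P D = 1 - prob_says_P P D"

text \<open>
  \<open>RN_deriv Q P\<close> is the density of \<open>P\<close> with respect to \<open>Q\<close>; it is meaningful only when
  \<open>absolutely_continuous Q P\<close>, that is, when every \<open>Q\<close>-null set is \<open>P\<close>-null.
\<close>

definition second_moment :: "'a measure \<Rightarrow> 'a measure \<Rightarrow> ennreal" where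
  "second_moment Q P = (\<integral>\<^sup>+ x. (RN_deriv Q P x)\<^sup>2 \<partial>Q)"

text \<open>
  In the bound \<open>(1 - \<beta>)\<^sup>2 / \<alpha> + \<beta>\<^sup>2 / (1 - \<alpha>) \<le> second_moment Q P\<close> division by zero is
  harmless. If \<open>P\<close> is absolutely continuous with respect to \<open>Q\<close>, then \<open>\<alpha> = 0\<close> forces \<open>\<beta> = 1\<close> and
  \<open>\<alpha> = 1\<close> forces \<open>\<beta> = 0\<close>, so a zero denominator occurs only as \<open>0 / 0\<close>, which is read as \<open>0\<close>.
\<close>

lemma distinguisher_deterministic:
  assumes "f \<in> M \<rightarrow>\<^sub>M count_space UNIV"
  shows "distinguisher M (deterministic f)"
  unfolding distinguisher_def deterministic_def
  by (rule measurable_compose[OF assms measurable_return_prob_space])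

lemma prob_says_P_deterministic:
  assumes "prob_space M" and f: "f \<in> M \<rightarrow>\<^sub>M count_space UNIV"
  shows "prob_says_P M (deterministic f) = measure M {x \<in> space M. f x = Says_P}"
proof -
  have "space M \<noteq> {}"
    using assms(1) by (rule prob_space.not_empty)
  then have "M \<bind> deterministic f = distr M (count_space UNIV) f"
    unfolding deterministic_def using f by (intro bind_return_distr') auto
  moreover have "f -` {Says_P} \<inter> space M = {x \<in> space M. f x = Says_P}"
    by auto
  ultimately show ?thesis
    unfolding prob_says_P_def using f by (simp add: measure_distr)
qed

end

theory Submission
  imports Defs
begin

text \<open>
  Write \<open>L\<close> for the density of \<open>P\<close> with respect to \<open>Q\<close>, and let \<open>g x\<close> be the probability that
  the distinguisher answers \<open>Says_P\<close> on the sample \<open>x\<close>, so that \<open>\<alpha> = \<integral> g dQ\<close> and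
  \<open>1 - \<beta> = \<integral> L g dQ\<close>. The bound is the Cauchy--Schwarz inequality for \<open>L\<close> with the weights
  \<open>g\<close> and \<open>1 - g\<close>, obtained here by integrating
  \<open>g (L - a)\<^sup>2 + (1 - g) (L - b)\<^sup>2 \<ge> 0\<close> for the optimal constants \<open>a = (1 - \<beta>) / \<alpha>\<close> and
  \<open>b = \<beta> / (1 - \<alpha>)\<close>. Equality holds when \<open>L\<close> is constant on each of the two cells of a
  deterministic test, in particular for two Bernoulli measures and the identity test.
\<close>

lemma prob_says_P_eq_integral:
  assumes "prob_space M" and D: "distinguisher M D"
  shows "prob_says_P M D = (\<integral>x. measure (D x) {Says_P} \<partial>M)"
proof -
  interpret prob_space M by fact
  have D': "D \<in> M \<rightarrow>\<^sub>M subprob_algebra (count_space UNIV)"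
    using D unfolding distinguisher_def by (rule measurable_prob_algebraD)
  have "emeasure (M \<bind> D) {Says_P} = (\<integral>\<^sup>+x. emeasure (D x) {Says_P} \<partial>M)"
    by (rule emeasure_bind[OF not_empty D']) simp
  also have "\<dots> = (\<integral>\<^sup>+x. ennreal (measure (D x) {Says_P}) \<partial>M)"
    using measurable_space[OF D']
    by (intro nn_integral_cong finite_measure.emeasure_eq_measure)
       (auto simp: space_subprob_algebra subprob_space_def)
  finally have "emeasure (M \<bind> D) {Says_P} = (\<integral>\<^sup>+x. ennreal (measure (D x) {Says_P}) \<partial>M)" .
  moreover have "(\<lambda>x. measure (D x) {Says_P}) \<in> borel_measurable M"
    by (rule measurable_compose[OF D' measurable_measure_subprob_algebra]) simp
  then have "(\<integral>x. measure (D x) {Says_P} \<partial>M)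
      = enn2real (\<integral>\<^sup>+x. ennreal (measure (D x) {Says_P}) \<partial>M)"
    by (rule integral_eq_nn_integral) simp
  ultimately show ?thesis
    unfolding prob_says_P_def measure_def[of "M \<bind> D"] by simp
qed

lemma (in prob_space) weighted_second_moment_lower_bound:
  fixes L g :: "'a \<Rightarrow> real"
  assumes [measurable]: "g \<in> borel_measurable M"
    and g: "\<And>x. x \<in> space M \<Longrightarrow> 0 \<le> g x \<and> g x \<le> 1"
    and L: "integrable M L" and L2: "integrable M (\<lambda>x. (L x)\<^sup>2)"
    and one: "(\<integral>x. L x \<partial>M) = 1"
  defines "\<alpha> \<equiv> \<integral>x. g x \<partial>M" and "p \<equiv> \<integral>x. L x * g x \<partial>M"
  shows "p\<^sup>2 / \<alpha> + (1 - p)\<^sup>2 / (1 - \<alpha>) \<le> (\<integral>x. (L x)\<^sup>2 \<partial>M)"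
proof -
  have [measurable]: "L \<in> borel_measurable M"
    using L by auto
  have ig: "integrable M g"
    using g by (intro integrable_const_bound[of _ 1]) auto
  have iLg: "integrable M (\<lambda>x. L x * g x)"
  proof (rule Bochner_Integration.integrable_bound[OF L])
    show "AE x in M. norm (L x * g x) \<le> norm (L x)"
      using g by (auto simp: abs_mult intro!: mult_left_le)
  qed simp
  \<comment> \<open>For arbitrary constants the argument yields the lower bound \<open>2 * a * p -
    a\<^sup>2 * \<alpha> + 2 * b * (1 - p) - b\<^sup>2 * (1 - \<alpha>)\<close>; for 0 < \<alpha> <
    1 it is concave in each constant and these values maximise it.\<close>
  define a where "a = p / \<alpha>"
  define b where "b = (1 - p) / (1 - \<alpha>)"
  have "0 \<le> (\<integral>x. g x * (L x - a)\<^sup>2 + (1 - g x) * (L x - b)\<^sup>2 \<partial>M)"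
    using g by (intro integral_nonneg_AE) auto
  \<comment> \<open>The weights add up to 1, so the square of \<open>L\<close> appears without
    \<open>g\<close>, and every remaining term has a known integral.\<close>
  also have "\<dots> = (\<integral>x. (L x)\<^sup>2 - 2 * (a - b) * (L x * g x) - 2 * b * L x
      + (a\<^sup>2 - b\<^sup>2) * g x + b\<^sup>2 \<partial>M)"
    by (intro Bochner_Integration.integral_cong) (auto simp: power2_eq_square algebra_simps)
  also have "\<dots> = (\<integral>x. (L x)\<^sup>2 \<partial>M) - 2 * (a - b) * p - 2 * b + (a\<^sup>2 - b\<^sup>2) * \<alpha> + b\<^sup>2"
    using L L2 ig iLg one by (simp add: \<alpha>_def p_def prob_space)
  finally have "(2 * a * p - a\<^sup>2 * \<alpha>) + (2 * b * (1 - p) - b\<^sup>2 * (1 - \<alpha>)) \<le> (\<integral>x. (L x)\<^sup>2 \<partial>M)"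
    by (simp add: algebra_simps)
  \<comment> \<open>If \<alpha> = 0, then \<open>a\<close> is 0 by the convention for division and
    both sides vanish; likewise for \<open>b\<close> when \<alpha> = 1.\<close>
  moreover have "2 * a * p - a\<^sup>2 * \<alpha> = p\<^sup>2 / \<alpha>"
    by (cases "\<alpha> = 0") (auto simp: a_def power2_eq_square)
  moreover have "2 * b * (1 - p) - b\<^sup>2 * (1 - \<alpha>) = (1 - p)\<^sup>2 / (1 - \<alpha>)"
    by (cases "1 - \<alpha> = 0") (auto simp: b_def power2_eq_square)
  ultimately show ?thesis by simp
qed

lemma second_moment_lower_bound:
  assumes P: "prob_space P" and Q: "prob_space Q" and sets: "sets P = sets Q"
    and D: "distinguisher Q D"
    and ac: "absolutely_continuous Q P" and fin: "second_moment Q P < \<infinity>"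
  shows "ennreal ((prob_says_P P D)\<^sup>2 / prob_says_P Q D
    + (1 - prob_says_P P D)\<^sup>2 / (1 - prob_says_P Q D)) \<le> second_moment Q P"
proof -
  interpret P: prob_space P by fact
  interpret Q: prob_space Q by fact
  \<comment> \<open>A real-valued version of the density allows the subtractions in the weighted
    bound.\<close>
  obtain L where [measurable]: "L \<in> borel_measurable Q"
    and RN: "AE x in Q. RN_deriv Q P x = ennreal (L x)" and nn: "\<And>x. 0 \<le> L x"
    using Q.real_RN_deriv[OF P.finite_measure_axioms ac sets] by metis
  have "density Q (RN_deriv Q P) = density Q L"
    using RN by (intro density_cong) auto
  then have dens: "P = density Q L"
    using Q.density_RN_deriv[OF ac sets] by simp
  define g where "g x = measure (D x) {Says_P}" for x
  have D': "D \<in> Q \<rightarrow>\<^sub>M subprob_algebra (count_space UNIV)"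
    using D unfolding distinguisher_def by (rule measurable_prob_algebraD)
  have [measurable]: "g \<in> borel_measurable Q"
    unfolding g_def by (rule measurable_compose[OF D']) simp
  have g: "0 \<le> g x \<and> g x \<le> 1" if "x \<in> space Q" for x
    using measurable_space[OF D' that]
    by (auto simp: g_def space_subprob_algebra intro: subprob_space.subprob_measure_le_1)
  have "distinguisher P D"
    using D sets measurable_cong_sets[OF sets refl] unfolding distinguisher_def by blast
  then have p: "prob_says_P P D = (\<integral>x. L x * g x \<partial>Q)"
    using prob_says_P_eq_integral[OF P] nn by (simp add: dens integral_density flip: g_def)
  \<comment> \<open>The total mass of \<open>P\<close>, rewritten as an integral over
    \<open>Q\<close>, gives both the integrability of \<open>L\<close> and its mean 1.\<close>
  have "integrable P (\<lambda>_. 1 :: real)"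
    by simp
  then have L: "integrable Q L"
    using nn by (simp add: dens integrable_density)
  have "(\<integral>x. 1 \<partial>P) = (\<integral>x. L x \<partial>Q)"
    using nn unfolding dens by (subst integral_density) auto
  then have one: "(\<integral>x. L x \<partial>Q) = 1"
    by (simp add: P.prob_space)
  have sm: "second_moment Q P = (\<integral>\<^sup>+x. ennreal ((L x)\<^sup>2) \<partial>Q)"
    unfolding second_moment_def using RN nn
    by (intro nn_integral_cong_AE) (auto simp: ennreal_power)
  \<comment> \<open>Finiteness of the second moment enters here: it lets the Bochner integral of the
    square stand for the extended nonnegative one.\<close>
  have L2: "integrable Q (\<lambda>x. (L x)\<^sup>2)"
    using fin by (intro integrableI_nonneg) (auto simp: sm)
  have "second_moment Q P = ennreal (\<integral>x. (L x)\<^sup>2 \<partial>Q)"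
    unfolding sm using L2 by (intro nn_integral_eq_integral) auto
  then show ?thesis
    using Q.weighted_second_moment_lower_bound[OF _ g L L2 one]
    by (simp add: p prob_says_P_eq_integral[OF Q D] ennreal_leI flip: g_def)
qed

text \<open>The density is the quotient of the point masses, and 0 < a < 1 keeps both denominators
  positive.\<close>

lemma density_bernoulli_pmf:
  assumes "0 < a" "a < 1" "0 \<le> p" "p \<le> 1"
  shows "density (bernoulli_pmf a) (\<lambda>x. ennreal (if x then p / a else (1 - p) / (1 - a)))
    = measure_pmf (bernoulli_pmf p)"
proof (rule measure_eqI)
  fix A :: "bool set"
  let ?h = "\<lambda>x. ennreal (if x then p / a else (1 - p) / (1 - a))"
  have "emeasure (density (bernoulli_pmf a) ?h) A
      = (\<integral>\<^sup>+x. ?h x * indicator A x \<partial>bernoulli_pmf a)"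
    by (simp add: emeasure_density)
  moreover have "ennreal (p / a) * ennreal a = ennreal p"
    "ennreal ((1 - p) / (1 - a)) * ennreal (1 - a) = ennreal (1 - p)"
    using assms by (simp_all flip: ennreal_mult)
  then have "(\<integral>\<^sup>+x. ?h x * indicator A x \<partial>bernoulli_pmf a)
      = (\<integral>\<^sup>+x. indicator A x \<partial>bernoulli_pmf p)"
    \<comment> \<open>The cases are the four subsets of \<open>bool\<close>; both integrals are to
      be expanded as two-point sums, so the right one must not be folded into a measure.\<close>
    using assms by (cases "True \<in> A"; cases "False \<in> A") (simp_all del: nn_integral_indicator)
  ultimately show "emeasure (density (bernoulli_pmf a) ?h) A = emeasure (bernoulli_pmf p) A"
    by simp
qed simp

lemma second_moment_bernoulli_pmf:
  assumes "0 < a" "a < 1" "0 \<le> p" "p \<le> 1"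
  shows "second_moment (bernoulli_pmf a) (bernoulli_pmf p)
    = ennreal (p\<^sup>2 / a + (1 - p)\<^sup>2 / (1 - a))"
proof -
  let ?h = "\<lambda>x. if x then p / a else (1 - p) / (1 - a)"
  \<comment> \<open>\<open>RN_deriv\<close> is pinned down only almost everywhere, which suffices
    under the integral.\<close>
  have "AE x in bernoulli_pmf a. ennreal (?h x) = RN_deriv (bernoulli_pmf a) (bernoulli_pmf p) x"
    by (rule measure_pmf.RN_deriv_unique[OF _ density_bernoulli_pmf[OF assms]]) simp
  then have "AE x in bernoulli_pmf a.
      (RN_deriv (bernoulli_pmf a) (bernoulli_pmf p) x)\<^sup>2 = (ennreal (?h x))\<^sup>2"
    by eventually_elim (simp only:)
  then have "second_moment (bernoulli_pmf a) (bernoulli_pmf p)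
      = (\<integral>\<^sup>+x. (ennreal (?h x))\<^sup>2 \<partial>bernoulli_pmf a)"
    unfolding second_moment_def by (rule nn_integral_cong_AE)
  also have "\<dots> = ennreal ((p / a)\<^sup>2 * a + ((1 - p) / (1 - a))\<^sup>2 * (1 - a))"
    using assms by (simp add: ennreal_power ennreal_mult ennreal_plus)
  also have "(p / a)\<^sup>2 * a + ((1 - p) / (1 - a))\<^sup>2 * (1 - a) = p\<^sup>2 / a + (1 - p)\<^sup>2 / (1 - a)"
    using assms by (simp add: power2_eq_square)
  finally show ?thesis .
qed

lemma second_moment_bound_tight:
  fixes \<alpha> \<beta> :: real
  assumes "0 < \<alpha>" "\<alpha> < 1" "0 < \<beta>" "\<beta> < 1"
  shows "\<exists>(P :: bool measure) (Q :: bool measure) (f :: bool \<Rightarrow> verdict).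
         prob_space P \<and> prob_space Q \<and> sets P = sets Q \<and>
         f \<in> Q \<rightarrow>\<^sub>M count_space UNIV \<and>
         \<alpha> = type_I_error Q (deterministic f) \<and> \<beta> = type_II_error P (deterministic f) \<and>
         absolutely_continuous Q P \<and>
         ennreal ((1 - \<beta>)\<^sup>2 / \<alpha> + \<beta>\<^sup>2 / (1 - \<alpha>)) = second_moment Q P"
proof -
  \<comment> \<open>The sample itself encodes the verdict, \<open>True\<close> meaning
    \<open>Says_P\<close>, so the prescribed errors dictate the two parameters.\<close>
  let ?P = "measure_pmf (bernoulli_pmf (1 - \<beta>))"
  let ?Q = "measure_pmf (bernoulli_pmf \<alpha>)"
  let ?f = "\<lambda>x. if x then Says_P else Says_Q"
  have says: "prob_says_P (bernoulli_pmf p) (deterministic ?f) = p" if "0 \<le> p" "p \<le> 1" for p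
  proof -
    have "{x. ?f x = Says_P} = {True}" by auto
    then show ?thesis
      using that prob_says_P_deterministic[of "measure_pmf (bernoulli_pmf p)" ?f]
      by (simp add: measure_pmf.prob_space_axioms measure_pmf_single)
  qed
  \<comment> \<open>\<open>?P\<close> has a density with respect to \<open>?Q\<close>;
    \<open>1 - (1 - \<beta>)\<close> is the form that \<open>p = 1 - \<beta>\<close> produces in
    \<open>density_bernoulli_pmf\<close>.\<close>
  have "absolutely_continuous ?Q ?P"
    using absolutely_continuousI_density[of "\<lambda>x. ennreal (if x then (1 - \<beta>) / \<alpha> else (1 - (1 - \<beta>)) / (1 - \<alpha>))" ?Q]
      density_bernoulli_pmf[of \<alpha> "1 - \<beta>"] assms
    by simp
  then show ?thesis
    using assms says[of \<alpha>] says[of "1 - \<beta>"] second_moment_bernoulli_pmf[of \<alpha> "1 - \<beta>"]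
    by (intro exI[of _ ?P] exI[of _ ?Q] exI[of _ ?f])
       (auto simp: type_I_error_def type_II_error_def measure_pmf.prob_space_axioms)
qed

theorem proposition2p5:
  "(\<forall>(P :: 'a measure) (Q :: 'a measure) (D :: 'a \<Rightarrow> verdict measure) \<alpha> \<beta>.
      prob_space P \<longrightarrow> prob_space Q \<longrightarrow> sets P = sets Q \<longrightarrow>
      distinguisher Q D \<longrightarrow>
      \<alpha> = type_I_error Q D \<longrightarrow> \<beta> = type_II_error P D \<longrightarrow>
      absolutely_continuous Q P \<longrightarrow> second_moment Q P < \<infinity> \<longrightarrow>
      ennreal ((1 - \<beta>)\<^sup>2 / \<alpha> + \<beta>\<^sup>2 / (1 - \<alpha>)) \<le> second_moment Q P)
   \<and>
   (\<forall>\<alpha> \<beta> :: real. 0 < \<alpha> \<longrightarrow> \<alpha> < 1 \<longrightarrow> 0 < \<beta> \<longrightarrow> \<beta> < 1 \<longrightarrow>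
      (\<exists>(P :: bool measure) (Q :: bool measure) (f :: bool \<Rightarrow> verdict).
         prob_space P \<and> prob_space Q \<and> sets P = sets Q \<and>
         f \<in> Q \<rightarrow>\<^sub>M count_space UNIV \<and>
         \<alpha> = type_I_error Q (deterministic f) \<and> \<beta> = type_II_error P (deterministic f) \<and>
         absolutely_continuous Q P \<and>
         ennreal ((1 - \<beta>)\<^sup>2 / \<alpha> + \<beta>\<^sup>2 / (1 - \<alpha>)) = second_moment Q P))"
  using second_moment_lower_bound second_moment_bound_tight
  by (auto simp: type_I_error_def type_II_error_def)

end
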